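(* $\tilde c:=\inf_{\theta\in\mathbb{F}_q((1/t))}\ \sup_{\gamma\in\mathbb{F}_q((1/t))}\ \liminf_{0\ne N\in\mathbb{F}_q[t],\ |N|\to\infty}|N|\cdot|\langle N\theta-\gamma\rangle|=q^{-2}$.
   Context: $q$ is a prime power, $\mathbb{F}_q[t]$ the polynomial ring over $\mathbb{F}_q$, and $\mathbb{F}_q((1/t))$ the field of Laurent series $\theta=\sum_i\theta_it^{-i}$ with finitely many nonzero coefficients of positive powers of $t$. Absolute value: $|\theta|=q^{\deg\theta}$ with $\deg\theta=\max\{-i:\theta_i\ne0\}$, $|0|=0$. Fractional part: $\langle\theta\rangle=\sum_{i\ge1}\theta_it^{-i}$. The liminf is over the nonzero polynomials $N$. *)

theory Defs
  imports
    "HOL-Computational_Algebra.Formal_Laurent_Series"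
    "HOL-Computational_Algebra.Polynomial"
    "HOL-Library.Extended_Real"
    "HOL-Library.Cardinality"
begin

unbundle fps_syntax

text \<open>
  The finite field with $q$ elements is a type \<^typ>\<open>'a\<close> of sort \<open>{field, finite}\<close>, with
  $q$ = \<open>CARD('a)\<close>. The field of Laurent series in $1/t$ is \<open>'a fls\<close>, whose formal variable
  \<^const>\<open>fls_X\<close> plays the role of $1/t$: the coefficient of $t^{-i}$ in \<open>\<theta>\<close> is \<open>\<theta> $$ i\<close>, and
  $t$ itself is \<^const>\<open>fls_X_inv\<close>.
\<close>

text \<open>
  The degree in $t$, i.e. the maximum of $-i$ over all $i$ with nonzero coefficient, is minus the
  least such $i$, which is \<^const>\<open>fls_subdegree\<close>.
\<close>

definition laurent_deg :: "'a::zero fls \<Rightarrow> int"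
  where "laurent_deg \<theta> = - fls_subdegree \<theta>"

lemma laurent_deg_greatest:
  assumes "\<theta> \<noteq> 0"
  shows "laurent_deg \<theta> = (GREATEST d. \<exists>i. d = - i \<and> \<theta> $$ i \<noteq> 0)"
proof (rule Greatest_equality[symmetric])
  show "\<exists>i. laurent_deg \<theta> = - i \<and> \<theta> $$ i \<noteq> 0"
    using assms by (auto simp: laurent_deg_def)
next
  fix d assume "\<exists>i. d = - i \<and> \<theta> $$ i \<noteq> 0"
  then show "d \<le> laurent_deg \<theta>"
    by (auto simp: laurent_deg_def intro: fls_subdegree_leI)
qed

definition laurent_abs :: "'a::{field,finite} fls \<Rightarrow> real"
  where "laurent_abs \<theta> = (if \<theta> = 0 then 0 else real CARD('a) powi laurent_deg \<theta>)"

definition frac_part :: "'a::zero fls \<Rightarrow> 'a fls"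
  where "frac_part \<theta> = fps_to_fls (Abs_fps (\<lambda>n. if n = 0 then 0 else \<theta> $$ int n))"

lemma frac_part_nth: "frac_part \<theta> $$ i = (if i \<ge> 1 then \<theta> $$ i else 0)"
  by (simp add: frac_part_def)

text \<open>The embedding of polynomials in $t$: evaluate at $t$, with coefficients as constants.\<close>

definition poly_to_laurent :: "'a::field poly \<Rightarrow> 'a fls"
  where "poly_to_laurent N = poly (map_poly fls_const N) fls_X_inv"

lemma poly_to_laurent_nth:
  "poly_to_laurent N $$ i = (if i \<le> 0 then coeff N (nat (- i)) else 0)"
proof (induction N arbitrary: i)
  case 0
  show ?case by (simp add: poly_to_laurent_def)
next
  case (pCons a p)
  have "poly_to_laurent (pCons a p) = fls_const a + fls_X_inv * poly_to_laurent p"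
    using pCons.hyps by (simp add: poly_to_laurent_def map_poly_pCons)
  then have "poly_to_laurent (pCons a p) $$ i =
      (if i = 0 then a else 0) + poly_to_laurent p $$ (i + 1)"
    by (simp add: fls_X_inv_times_conv_shift)
  also have "\<dots> = (if i \<le> 0 then coeff (pCons a p) (nat (- i)) else 0)"
  proof (cases "i < 0")
    case True
    then have "nat (- i) = Suc (nat (- (i + 1)))" by simp
    with True show ?thesis by (simp add: pCons.IH)
  qed (auto simp: pCons.IH)
  finally show ?case .
qed

text \<open>
  The filter of nonzero polynomials $N$ with $|N| \to \infty$: a property holds eventually iff there
  is a bound $R$ such that it holds for all nonzero $N$ with $|N| \ge R$.
\<close>

definition poly_at_infinity :: "'a::{field,finite} poly filter"
  where "poly_at_infinity =
    inf (filtercomap (\<lambda>N. laurent_abs (poly_to_laurent N)) at_top) (principal {N. N \<noteq> 0})"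

end

theory Submission
  imports Defs "HOL-Library.FuncSet"
begin

text \<open>
  Lower bound: if \<open>N\<close> has degree at most \<open>n\<close> and the coefficients of $N\theta - \gamma$ at
  $t^{-1}, \dots, t^{-(n+2)}$ vanish, then any $M$ of degree at most $n+1$ for which the coefficients of
  $M\theta$ at $t^{-1}, \dots, t^{-(n+1)}$ vanish has $(M\gamma)_1 = 0$: compare the coefficient at $t^{-1}$ in
  $M(N\theta - \gamma)$. Nonzero such $M$ exist by the pigeonhole principle, and a monic one of least
  degree is determined by this degree alone. Hence $\gamma$ can be built coefficient by coefficient
  such that $(M\gamma)_1 = 1$ for all these $M$.

  Upper bound: take $\theta = \sum_k t^{-3^k}$ and put $a = 3^k$. For every $\gamma$, if the coefficient of
  $\gamma$ at $t^{-(a+1)}$ is nonzero, then there is an $N$ of degree $2a-1$ such that $N\theta - \gamma$ has no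
  terms at $t^{-1}, \dots, t^{-2a}$; otherwise there is an $N$ of degree $a$ such that it has none at
  $t^{-1}, \dots, t^{-(a+1)}$.
\<close>

text \<open>With unit diagonal, each equation yields \<open>f n\<close> from earlier values, so
  recursion along \<open><\<close> solves the system. It serves to build \<gamma> in the lower bound
  and the lower half of \<open>N\<close> in the upper bound.\<close>

lemma triangular_system_solvable:
  fixes c :: "nat \<Rightarrow> nat \<Rightarrow> 'a::ring"
  shows "\<exists>f. \<forall>n. f n + (\<Sum>j<n. c n j * f j) = b n"
proof -
  define R where "R = {(j, n :: nat). j < n}"
  have "wf R"
    unfolding R_def by (rule wf)
  define f where "f = wfrec R (\<lambda>g n. b n - (\<Sum>j<n. c n j * g j))"
  have "f n = b n - (\<Sum>j<n. c n j * f j)" for n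
    unfolding f_def by (subst wfrec[OF \<open>wf R\<close>]) (simp add: cut_def R_def)
  then show ?thesis
    by (intro exI[of _ f]) (simp add: algebra_simps)
qed

lemma card_field_ge_2: "CARD('a::{field,finite}) \<ge> 2"
proof -
  have "card {0, 1 :: 'a} \<le> CARD('a)"
    by (rule card_mono) auto
  then show ?thesis by simp
qed

subsection \<open>Coefficients and absolute values\<close>

lemma poly_to_laurent_times_nth:
  assumes "degree N \<le> n"
  shows "(poly_to_laurent N * \<theta>) $$ m = (\<Sum>i\<le>n. coeff N i * \<theta> $$ (m + int i))"
  using assms
proof (induction N arbitrary: m n)
  case 0
  show ?case by (simp add: poly_to_laurent_def)
next
  case (pCons a p)
  have "poly_to_laurent (pCons a p) * \<theta> = fls_const a * \<theta> + fls_X_inv * (poly_to_laurent p * \<theta>)"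
    using pCons.hyps by (simp add: poly_to_laurent_def map_poly_pCons algebra_simps)
  then have eq: "(poly_to_laurent (pCons a p) * \<theta>) $$ m = a * \<theta> $$ m + (poly_to_laurent p * \<theta>) $$ (m + 1)"
    by (simp add: fls_X_inv_times_conv_shift)
  show ?case
  proof (cases n)
    case 0
    with pCons.prems have "p = 0" by (auto split: if_splits)
    then show ?thesis using eq 0 by (simp add: poly_to_laurent_def)
  next
    case (Suc n')
    with pCons.prems have "degree p \<le> n'" by (auto split: if_splits)
    from pCons.IH[OF this, of "m + 1"] show ?thesis
      unfolding eq Suc sum.atMost_Suc_shift by (simp add: add_ac)
  qed
qed

text \<open>Both sides are the coefficient of M N \<theta> at t^-1: expanded, each is the double sum
  of M_j N_i \<theta>_(1+i+j).\<close>

lemma poly_to_laurent_pairing: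
  assumes "degree M \<le> k" and "degree N \<le> n"
  shows "(\<Sum>j\<le>k. coeff M j * (poly_to_laurent N * \<theta>) $$ (1 + int j))
       = (\<Sum>i\<le>n. coeff N i * (poly_to_laurent M * \<theta>) $$ (1 + int i))"
  unfolding poly_to_laurent_times_nth[OF assms(1)] poly_to_laurent_times_nth[OF assms(2)]
  by (simp add: sum_distrib_left sum.swap[of _ "{..k}"] ac_simps)

lemma poly_to_laurent_diff:
  "poly_to_laurent (M - M') = poly_to_laurent M - poly_to_laurent M'"
  by (simp add: fls_eq_iff poly_to_laurent_nth)

lemma laurent_abs_poly_to_laurent:
  fixes N :: "'a::{field,finite} poly"
  assumes "N \<noteq> 0"
  shows "laurent_abs (poly_to_laurent N) = real CARD('a) ^ degree N"
proof -
  have "fls_subdegree (poly_to_laurent N) = - int (degree N)"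
    by (rule fls_subdegree_eqI) (use assms in \<open>auto simp: poly_to_laurent_nth intro!: coeff_eq_0\<close>)
  moreover have "poly_to_laurent N \<noteq> 0"
    using assms by (auto simp: fls_eq_iff poly_to_laurent_nth intro!: exI[of _ "- int (degree N)"])
  ultimately show ?thesis
    by (simp add: laurent_abs_def laurent_deg_def)
qed

lemma laurent_abs_frac_part_ge:
  fixes x :: "'a::{field,finite} fls"
  assumes "x $$ m \<noteq> 0" and "1 \<le> m" and "m \<le> int k"
  shows "laurent_abs (frac_part x) \<ge> 1 / real CARD('a) ^ k"
proof -
  have nz: "frac_part x $$ m \<noteq> 0"
    using assms by (simp add: frac_part_nth)
  then have "fls_subdegree (frac_part x) \<le> m"
    by (rule fls_subdegree_leI)
  then have "real CARD('a) powi (- int k) \<le> real CARD('a) powi laurent_deg (frac_part x)"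
    using assms card_field_ge_2[where 'a = 'a]
    by (intro power_int_increasing) (auto simp: laurent_deg_def)
  moreover have "frac_part x \<noteq> 0"
    using nz by auto
  ultimately show ?thesis
    by (simp add: laurent_abs_def power_int_minus divide_inverse)
qed

lemma laurent_abs_frac_part_le:
  fixes x :: "'a::{field,finite} fls"
  assumes "\<And>m. 1 \<le> m \<Longrightarrow> m \<le> int k \<Longrightarrow> x $$ m = 0"
  shows "laurent_abs (frac_part x) \<le> 1 / real CARD('a) ^ Suc k"
\<comment> \<open>The zero series is treated apart, since \<open>fls_subdegree 0\<close> is 0 by
  convention.\<close>
proof (cases "frac_part x = 0")
  case True
  then show ?thesis by (simp add: laurent_abs_def)
next
  case False
  have "fls_subdegree (frac_part x) \<ge> int (Suc k)"
    using False assms by (intro fls_subdegree_geI) (auto simp: frac_part_nth)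
  then have "real CARD('a) powi laurent_deg (frac_part x) \<le> real CARD('a) powi (- int (Suc k))"
    using card_field_ge_2[where 'a = 'a]
    by (intro power_int_increasing) (auto simp: laurent_deg_def)
  with False show ?thesis
    by (simp only: laurent_abs_def power_int_minus divide_inverse power_int_of_nat if_False mult_1)
qed

subsection \<open>Lower bound\<close>

text \<open>Over a field with q elements this says that M \<theta> is at distance less than q^-n
  from some polynomial; a nonzero M is then the denominator of a good rational approximation to
  \<theta>.\<close>

definition approximates_zero :: "'a::field fls \<Rightarrow> nat \<Rightarrow> 'a poly \<Rightarrow> bool"
  where "approximates_zero \<theta> n M \<longleftrightarrow> (\<forall>m\<in>{1..int n}. (poly_to_laurent M * \<theta>) $$ m = 0)"

lemma approximates_zero_mono:
  "approximates_zero \<theta> n M \<Longrightarrow> k \<le> n \<Longrightarrow> approximates_zero \<theta> k M"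
  by (auto simp: approximates_zero_def)

lemma approximates_zero_diff:
  assumes "approximates_zero \<theta> n M" and "approximates_zero \<theta> n M'"
  shows "approximates_zero \<theta> n (M - M')"
  using assms by (simp add: approximates_zero_def poly_to_laurent_diff left_diff_distrib)

lemma approximates_zero_smult:
  assumes "approximates_zero \<theta> n M"
  shows "approximates_zero \<theta> n (smult c M)"
proof -
  have "poly_to_laurent (smult c M) = fls_const c * poly_to_laurent M"
    by (simp add: fls_eq_iff poly_to_laurent_nth)
  then show ?thesis
    using assms by (simp add: approximates_zero_def mult.assoc)
qed

text \<open>The analogue of Dirichlet's approximation theorem: q^(n+1) polynomials share only q^n
  possible coefficient tuples, and the difference of two with the same tuple is the required
  \<open>M\<close>.\<close>

lemma approximates_zero_exists:
  fixes \<theta> :: "'a::{field,finite} fls"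
  shows "\<exists>M. M \<noteq> 0 \<and> degree M \<le> n \<and> approximates_zero \<theta> n M"
proof -
  define A :: "'a poly set" where "A = {M. degree M \<le> n}"
  define B where "B = PiE {1..int n} (\<lambda>_. UNIV :: 'a set)"
  define F where "F M = (\<lambda>m\<in>{1..int n}. (poly_to_laurent M * \<theta>) $$ m)" for M
  \<comment> \<open>\<open>P\<close> parametrizes polynomials by their coefficient tuples; its
    injectivity supplies the count q^(n+1).\<close>
  define P where "P f = (\<Sum>i\<le>n. monom (f i) i)" for f :: "nat \<Rightarrow> 'a"
  have coeff_P: "coeff (P f) i = (if i \<le> n then f i else 0)" for f i
    by (simp add: P_def coeff_sum)
  have "inj_on P (PiE {..n} (\<lambda>_. UNIV))"
  proof (rule inj_onI)
    fix f g assume *: "f \<in> PiE {..n} (\<lambda>_. UNIV)" "g \<in> PiE {..n} (\<lambda>_. UNIV)" "P f = P g"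
    then show "f = g"
      by (intro PiE_ext[OF *(1,2)]) (metis atMost_iff coeff_P)
  qed
  then have P_card: "card (P ` PiE {..n} (\<lambda>_. UNIV)) = CARD('a) ^ Suc n"
    by (simp add: card_image card_PiE)
  have P_sub: "P ` PiE {..n} (\<lambda>_. UNIV) \<subseteq> A"
    by (auto simp: A_def coeff_P intro!: degree_le)
  have "card B = CARD('a) ^ n"
    by (simp add: B_def card_PiE)
  have "\<not> inj_on F (P ` PiE {..n} (\<lambda>_. UNIV))"
  proof
    assume "inj_on F (P ` PiE {..n} (\<lambda>_. UNIV))"
    then have "CARD('a) ^ Suc n \<le> card B"
      unfolding P_card[symmetric]
      by (rule card_inj_on_le) (auto simp: B_def F_def finite_PiE)
    also have "\<dots> < CARD('a) ^ Suc n"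
      using card_field_ge_2[where 'a = 'a] \<open>card B = _\<close> by simp
    finally show False by simp
  qed
  with P_sub obtain M M' where M: "M \<in> A" "M' \<in> A" "M \<noteq> M'" "F M = F M'"
    by (auto simp: inj_on_def subset_iff)
  have "(poly_to_laurent M * \<theta>) $$ m = (poly_to_laurent M' * \<theta>) $$ m" if "m \<in> {1..int n}" for m
    using fun_cong[OF M(4), of m] that by (simp add: F_def)
  then have "approximates_zero \<theta> n (M - M')"
    by (auto simp: approximates_zero_def poly_to_laurent_diff left_diff_distrib)
  moreover have "degree (M - M') \<le> n"
    using M(1,2) by (simp add: A_def degree_diff_le)
  ultimately show ?thesis
    using M(3) by (intro exI[of _ "M - M'"]) simp
qed

lemma approximates_zero_minimal:
  fixes \<theta> :: "'a::{field,finite} fls"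
  obtains M where "lead_coeff M = 1" and "degree M \<le> n" and "approximates_zero \<theta> n M"
    and "\<And>M'. M' \<noteq> 0 \<Longrightarrow> approximates_zero \<theta> n M' \<Longrightarrow> degree M \<le> degree M'"
proof -
  define S where "S M \<longleftrightarrow> M \<noteq> 0 \<and> approximates_zero \<theta> n M" for M
  obtain M0 where M0: "S M0" "degree M0 \<le> n"
    using approximates_zero_exists[of n \<theta>] by (auto simp: S_def)
  obtain M where M: "S M" "\<And>M'. S M' \<Longrightarrow> degree M \<le> degree M'"
    using exists_least_iff[of "\<lambda>d. \<exists>M. S M \<and> degree M = d"] M0 by (metis not_le)
  show thesis
  proof (rule that[of "smult (inverse (lead_coeff M)) M"])
    show "degree (smult (inverse (lead_coeff M)) M) \<le> n"
      using M(2)[OF M0(1)] M0(2) by simp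
  qed (use M in \<open>auto simp: S_def intro: approximates_zero_smult\<close>)
qed

text \<open>A single \<gamma> must serve all \<open>N\<close>. Taking \<open>n\<close> to be the
  degree of \<open>N\<close> yields the bound q^-2 for every nonzero \<open>N\<close>.\<close>

lemma badly_approximable_shift_exists:
  fixes \<theta> :: "'a::{field,finite} fls"
  obtains \<gamma> where "\<And>N n. degree N \<le> n \<Longrightarrow> \<exists>m\<in>{1..int (n + 2)}. (poly_to_laurent N * \<theta> - \<gamma>) $$ m \<noteq> 0"
proof -
  have "\<exists>M. lead_coeff M = 1 \<and> degree M \<le> n \<and> approximates_zero \<theta> n M \<and>
      (\<forall>M'. M' \<noteq> 0 \<longrightarrow> approximates_zero \<theta> n M' \<longrightarrow> degree M \<le> degree M')" for n
    by (rule approximates_zero_minimal[of n \<theta>]) blast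
  then obtain M where M: "lead_coeff (M n) = 1" "degree (M n) \<le> n" "approximates_zero \<theta> n (M n)"
    and M_min: "\<And>M'. M' \<noteq> 0 \<Longrightarrow> approximates_zero \<theta> n M' \<Longrightarrow> degree (M n) \<le> degree M'" for n
    by metis
  \<comment> \<open>\<open>M k\<close> also meets the weaker conditions for \<open>n\<close>. The
    difference of two monic polynomials of equal degree has smaller degree, so if nonzero it would
    contradict the minimality of \<open>M n\<close>.\<close>
  have M_le: "M n = M k" if "degree (M n) = degree (M k)" and "n \<le> k" for n k
  proof (rule ccontr)
    assume "M n \<noteq> M k"
    have "approximates_zero \<theta> n (M n - M k)"
      using M(3)[of n] M(3)[of k] that(2) by (blast intro: approximates_zero_diff approximates_zero_mono)
    then have "degree (M n) \<le> degree (M n - M k)"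
      using \<open>M n \<noteq> M k\<close> by (intro M_min) auto
    moreover have "coeff (M n - M k) (degree (M n)) = 0"
      using M(1)[of n] M(1)[of k] that(1) by simp
    moreover have "degree (M n - M k) \<le> degree (M n)"
      using that(1) by (intro degree_diff_le) auto
    ultimately show False
      using \<open>M n \<noteq> M k\<close> by (metis eq_iff_diff_eq_0 le_antisym leading_coeff_0_iff)
  qed
  have M_eq: "M n = M k" if "degree (M n) = degree (M k)" for n k
    using M_le[OF that] M_le[OF that[symmetric]] nat_le_linear[of n k] by metis
  \<comment> \<open>Indexing by degree leaves one equation for each \<open>e\<close>. If no
    \<open>M n\<close> has degree \<open>e\<close>, then \<open>P e\<close> is arbitrary, but its
    equation is still solvable because the coefficient of \<open>f e\<close> is set to 1.\<close>
  define P where "P e = M (SOME n. degree (M n) = e)" for e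
  have P: "P (degree (M n)) = M n" for n
    unfolding P_def by (rule M_eq, rule someI[of "\<lambda>k. degree (M k) = degree (M n)" n]) simp
  obtain f where f: "\<And>e. f e + (\<Sum>j<e. coeff (P e) j * f j) = 1"
    using triangular_system_solvable[of "\<lambda>e. coeff (P e)" "\<lambda>_. 1"] by auto
  \<comment> \<open>The shift puts \<open>f j\<close> at t^-(j+1). When \<open>P e\<close> is monic
    of degree \<open>e\<close>, the equation for \<open>f e\<close> then says that P_e \<gamma> has
    coefficient 1 at t^-1.\<close>
  define \<gamma> where "\<gamma> = fps_to_fls (Abs_fps (\<lambda>n. if n = 0 then 0 else f (n - 1)))"
  have \<gamma>: "\<gamma> $$ (1 + int j) = f j" for j
    by (simp add: \<gamma>_def nat_add_distrib)
  show thesis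
  proof (rule that[of \<gamma>], rule ccontr)
    fix N :: "'a poly" and n
    assume N: "degree N \<le> n" and "\<not> (\<exists>m\<in>{1..int (n + 2)}. (poly_to_laurent N * \<theta> - \<gamma>) $$ m \<noteq> 0)"
    then have eq: "(poly_to_laurent N * \<theta>) $$ (1 + int j) = f j" if "j \<le> n + 1" for j
      using that by (auto simp flip: \<gamma>)
    \<comment> \<open>The index \<open>n + 1\<close> fits both sides: degree at most n+1 involves
      \<gamma> only up to t^-(n+2), and the vanishing of M \<theta> up to t^-(n+1) covers every
      \<open>i \<le> n\<close> in the pairing.\<close>
    define e where "e = degree (M (n + 1))"
    have "e \<le> n + 1"
      unfolding e_def by (rule M(2))
    have "(\<Sum>j\<le>e. coeff (M (n + 1)) j * f j) =
        (\<Sum>j\<le>e. coeff (M (n + 1)) j * (poly_to_laurent N * \<theta>) $$ (1 + int j))"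
      using \<open>e \<le> n + 1\<close> by (intro sum.cong) (auto simp: eq)
    also have "\<dots> = (\<Sum>i\<le>n. coeff N i * (poly_to_laurent (M (n + 1)) * \<theta>) $$ (1 + int i))"
      using N by (intro poly_to_laurent_pairing) (auto simp: e_def)
    also have "\<dots> = 0"
      using M(3)[of "n + 1"] by (intro sum.neutral) (auto simp: approximates_zero_def)
    finally have "(\<Sum>j\<le>e. coeff (M (n + 1)) j * f j) = 0" .
    moreover have "(\<Sum>j\<le>e. coeff (M (n + 1)) j * f j) = f e + (\<Sum>j<e. coeff (P e) j * f j)"
      using M(1)[of "n + 1"] by (simp add: e_def P add.commute flip: lessThan_Suc_atMost)
    ultimately show False
      using f[of e] by simp
  qed
qed

subsection \<open>Upper bound\<close>

definition lacunary_series :: "'a::{zero,one} fls"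
  where "lacunary_series = fps_to_fls (Abs_fps (\<lambda>n. if \<exists>j. n = 3 ^ j then 1 else 0))"

lemma lacunary_series_nth_power: "lacunary_series $$ int (3 ^ k) = 1"
  by (auto simp: lacunary_series_def simp del: of_nat_power)

lemma lacunary_series_nth_between:
  assumes "3 ^ k < n" and "n < 3 ^ Suc k"
  shows "lacunary_series $$ int n = 0"
proof -
  have "n \<noteq> 3 ^ j" for j
  proof
    assume "n = 3 ^ j"
    with assms have "k < j" and "j < Suc k"
      by (metis one_less_numeral_iff power_strict_increasing_iff semiring_norm(77))+
    then show False by simp
  qed
  then show ?thesis by (simp add: lacunary_series_def)
qed

text \<open>Vanishing up to t^-(deg N + 1) bounds the product by q^-2. The gap from a to 3a makes
  the conditions up to t^-a triangular in the lower coefficients of \<open>N\<close>, while each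
  later one involves a single upper coefficient.\<close>

lemma lacunary_series_good_approximation:
  fixes \<gamma> :: "'a::field fls"
  assumes "k \<ge> 1"
  obtains N where "degree N \<ge> 3 ^ k" and "N \<noteq> 0"
    and "\<And>m. 1 \<le> m \<Longrightarrow> m \<le> int (Suc (degree N)) \<Longrightarrow> (poly_to_laurent N * lacunary_series - \<gamma>) $$ m = 0"
proof -
  define \<theta> :: "'a fls" where "\<theta> = lacunary_series"
  note good = that[folded \<theta>_def]
  define a :: nat where "a = 3 ^ k"
  have "(3::nat) ^ 1 \<le> 3 ^ k"
    using assms by (intro power_increasing) auto
  then have a: "a \<ge> 3" by (simp add: a_def)
  have \<theta>_a: "\<theta> $$ int a = 1"
    unfolding \<theta>_def a_def by (rule lacunary_series_nth_power)
  have \<theta>_3a: "\<theta> $$ int (3 * a) = 1"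
    unfolding \<theta>_def a_def power_Suc[symmetric] by (rule lacunary_series_nth_power)
  \<comment> \<open>Indices m+i with m at most 2a and i below 2a stay below 4a, hence below the next
    exponent 9a.\<close>
  have \<theta>_0: "\<theta> $$ int n = 0" if "a < n" "n \<noteq> 3 * a" "n < 4 * a" for n
    using that lacunary_series_nth_between[of k n] lacunary_series_nth_between[of "Suc k" n]
    by (cases "n < 3 * a") (auto simp: \<theta>_def a_def)
  \<comment> \<open>For \<open>n < a\<close> this is the condition at t^-(a-n); the entry for i = n
    is \<theta>_a = 1.\<close>
  obtain f where f: "\<And>n. f n + (\<Sum>i<n. \<theta> $$ int (a - n + i) * f i) = \<gamma> $$ int (a - n)"
    using triangular_system_solvable[of "\<lambda>n i. \<theta> $$ int (a - n + i)" "\<lambda>n. \<gamma> $$ int (a - n)"] by auto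
  define N where "N g = (\<Sum>i<2*a. monom (if i < a then f i else g i) i)" for g
  have coeff_N: "coeff (N g) i = (if i < a then f i else if i < 2 * a then g i else 0)" for g i
    by (auto simp: N_def coeff_sum)
  have N_nth: "(poly_to_laurent (N g) * \<theta>) $$ int m =
      (\<Sum>i<2*a. coeff (N g) i * \<theta> $$ int (m + i))" for g m
  proof -
    have "degree (N g) \<le> 2 * a - 1"
      using a by (intro degree_le) (auto simp: coeff_N)
    then have "(poly_to_laurent (N g) * \<theta>) $$ int m =
        (\<Sum>i\<le>2*a-1. coeff (N g) i * \<theta> $$ int (m + i))"
      by (simp add: poly_to_laurent_times_nth)
    also have "{..2*a-1} = {..<2*a}" using a by auto
    finally show ?thesis .
  qed
  \<comment> \<open>Here m+i < 3a, so \<theta> vanishes once i > a-m and the upper half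
    \<open>g\<close> has no influence.\<close>
  have low: "(poly_to_laurent (N g) * \<theta>) $$ int m = \<gamma> $$ int m" if "1 \<le> m" "m \<le> a" for g m
  proof -
    define n where "n = a - m"
    have n: "n < a" "m = a - n"
      using that by (auto simp: n_def)
    have "(poly_to_laurent (N g) * \<theta>) $$ int m = (\<Sum>i<Suc n. coeff (N g) i * \<theta> $$ int (m + i))"
      unfolding N_nth
    proof (rule sum.mono_neutral_right)
      show "\<forall>i\<in>{..<2*a} - {..<Suc n}. coeff (N g) i * \<theta> $$ int (m + i) = 0"
        using n by (intro ballI mult_eq_0_iff[THEN iffD2] disjI2 \<theta>_0) auto
    qed (use n in auto)
    also have "\<dots> = f n + (\<Sum>i<n. \<theta> $$ int (a - n + i) * f i)"
      using n \<theta>_a by (simp add: coeff_N mult.commute add.commute)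
    finally show ?thesis using f[of n] n by simp
  qed
  \<comment> \<open>Here a < m+i < 4a, so only m+i = 3a contributes, and 3a-m lies in the upper
    half.\<close>
  have high: "(poly_to_laurent (N g) * \<theta>) $$ int m = g (3 * a - m)" if "a < m" "m \<le> 2 * a" for g m
  proof -
    have "(poly_to_laurent (N g) * \<theta>) $$ int m = (\<Sum>i\<in>{3*a-m}. coeff (N g) i * \<theta> $$ int (m + i))"
      unfolding N_nth using that
      by (intro sum.mono_neutral_right) (auto simp del: of_nat_add intro!: \<theta>_0)
    also have "\<dots> = g (3 * a - m)"
    proof -
      have "\<not> 3 * a - m < a" and "3 * a - m < 2 * a" and "m + (3 * a - m) = 3 * a"
        using that by auto
      then show ?thesis
        using \<theta>_3a unfolding coeff_N by simp
    qed
    finally show ?thesis .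
  qed
  have goal: thesis if deg: "degree (N g) = d" and d: "a \<le> d" "d < 2 * a"
    and match: "\<And>m. a < m \<Longrightarrow> m \<le> Suc d \<Longrightarrow> \<gamma> $$ int m = g (3 * a - m)" for g d
  proof (rule good[of "N g"])
    show "3 ^ k \<le> degree (N g)" and "N g \<noteq> 0"
      using deg d a by (auto simp flip: a_def)
    fix m :: int assume m: "1 \<le> m" "m \<le> int (Suc (degree (N g)))"
    then obtain m' where m': "m = int m'"
      using zero_le_imp_eq_int by fastforce
    show "(poly_to_laurent (N g) * \<theta> - \<gamma>) $$ m = 0"
      using m deg d low[of m' g] high[of m' g] match[of m'] by (cases "m' \<le> a") (auto simp: m')
  qed
  show thesis
  \<comment> \<open>Matching \<gamma> up to t^-2a forces the coefficient of t^(2a-1) in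
    \<open>N\<close> to be \<gamma>_(a+1). If that is zero the degree drops, so the other case fixes
    degree a and matches only one further coefficient.\<close>
  proof (cases "\<gamma> $$ int (a + 1) = 0")
    case False
    define g where "g i = \<gamma> $$ int (3 * a - i)" for i
    have "3 * a - (2 * a - 1) = a + 1" using a by simp
    then have "coeff (N g) (2 * a - 1) \<noteq> 0"
      using False a unfolding coeff_N g_def by simp
    then have "degree (N g) = 2 * a - 1"
      using a by (intro antisym degree_le le_degree) (auto simp: coeff_N)
    then show thesis
      by (rule goal) (use a in \<open>auto simp: g_def\<close>)
  next
    case True
    \<comment> \<open>The entry 1 makes the degree exactly a. The condition at t^-(a+1) reads
      g(2a-1) = 0, which holds since 2a-1 > a.\<close>
    define g :: "nat \<Rightarrow> 'a" where "g i = (if i = a then 1 else 0)" for i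
    have "degree (N g) = a"
      using a by (intro antisym degree_le le_degree) (auto simp: coeff_N g_def)
    then show thesis
    proof (rule goal)
      fix m assume "a < m" "m \<le> Suc a"
      then have "m = a + 1" by simp
      then show "\<gamma> $$ int m = g (3 * a - m)"
        using True a by (simp add: g_def)
    qed (use a in auto)
  qed
qed

section \<open>Passage from the two bounds to the infimum, supremum and liminf\<close>

theorem theorem3p11:
  shows "(INF \<theta>::'a::{field,finite} fls. SUP \<gamma>::'a fls.
            Liminf poly_at_infinity
              (\<lambda>N. ereal (laurent_abs (poly_to_laurent N)
                            * laurent_abs (frac_part (poly_to_laurent N * \<theta> - \<gamma>)))))
         = ereal (1 / real CARD('a) ^ 2)"
    (is "(INF \<theta>. SUP \<gamma>. Liminf _ (?F \<theta> \<gamma>)) = ereal ?c")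
proof (rule antisym)
  have q: "real CARD('a) \<ge> 2"
    using card_field_ge_2[where 'a = 'a] by simp
  show "(INF \<theta>. SUP \<gamma>. Liminf poly_at_infinity (?F \<theta> \<gamma>)) \<le> ereal ?c"
  proof (rule INF_lower2[of lacunary_series], simp, rule SUP_least, rule ccontr)
    fix \<gamma> :: "'a fls"
    assume "\<not> Liminf poly_at_infinity (?F lacunary_series \<gamma>) \<le> ereal ?c"
    then have "eventually (\<lambda>N. ereal ?c < ?F lacunary_series \<gamma> N) poly_at_infinity"
      by (intro less_LiminfD) simp
    then obtain R where R: "\<And>N. N \<noteq> 0 \<Longrightarrow> R \<le> laurent_abs (poly_to_laurent N) \<Longrightarrow>
        ereal ?c < ?F lacunary_series \<gamma> N"
      unfolding poly_at_infinity_def eventually_inf_principal eventually_filtercomap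
        eventually_at_top_linorder by blast
    \<comment> \<open>As 3^(k+1) exceeds k, an \<open>N\<close> of degree at least 3^(k+1) lies
      beyond the threshold \<open>R\<close>.\<close>
    obtain k where k: "R < real CARD('a) ^ k"
      using real_arch_pow[of "real CARD('a)" R] q by auto
    obtain N :: "'a poly" where N: "degree N \<ge> 3 ^ Suc k" "N \<noteq> 0"
      "\<And>m. 1 \<le> m \<Longrightarrow> m \<le> int (Suc (degree N)) \<Longrightarrow> (poly_to_laurent N * lacunary_series - \<gamma>) $$ m = 0"
      using lacunary_series_good_approximation[of "Suc k" \<gamma>] by auto
    have "k \<le> degree N"
      using N(1) less_exp[of "Suc k"] power_mono[of 2 "3::nat" "Suc k"] by linarith
    then have "real CARD('a) ^ k \<le> real CARD('a) ^ degree N"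
      using q by (intro power_increasing) auto
    with k N(2) have "ereal ?c < ?F lacunary_series \<gamma> N"
      by (intro R) (auto simp: laurent_abs_poly_to_laurent)
    moreover have "laurent_abs (frac_part (poly_to_laurent N * lacunary_series - \<gamma>)) \<le>
        1 / real CARD('a) ^ Suc (Suc (degree N))"
      using N(3) by (rule laurent_abs_frac_part_le)
    then have "real CARD('a) ^ degree N * laurent_abs (frac_part (poly_to_laurent N * lacunary_series - \<gamma>))
        \<le> real CARD('a) ^ degree N * (1 / real CARD('a) ^ Suc (Suc (degree N)))"
      by (rule mult_left_mono) simp
    moreover have "\<dots> = ?c"
      using q by (simp add: power2_eq_square)
    ultimately show False
      using N(2) by (simp add: laurent_abs_poly_to_laurent)
  qed
  show "ereal ?c \<le> (INF \<theta>. SUP \<gamma>. Liminf poly_at_infinity (?F \<theta> \<gamma>))"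
  proof (rule INF_greatest)
    fix \<theta> :: "'a fls"
    obtain \<gamma> where \<gamma>: "\<And>N n. degree N \<le> n \<Longrightarrow>
        \<exists>m\<in>{1..int (n + 2)}. (poly_to_laurent N * \<theta> - \<gamma>) $$ m \<noteq> 0"
      by (rule badly_approximable_shift_exists[of \<theta>]) blast
    have "ereal ?c \<le> ?F \<theta> \<gamma> N" if "N \<noteq> 0" for N
    proof -
      from \<gamma>[OF order_refl, of N] obtain m where m: "1 \<le> m" "m \<le> int (degree N + 2)"
        "(poly_to_laurent N * \<theta> - \<gamma>) $$ m \<noteq> 0"
        by auto
      have "?c = real CARD('a) ^ degree N * (1 / real CARD('a) ^ (degree N + 2))"
        using q by (simp add: power_add power2_eq_square)
      also have "\<dots> \<le> real CARD('a) ^ degree N * laurent_abs (frac_part (poly_to_laurent N * \<theta> - \<gamma>))"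
        by (intro mult_left_mono laurent_abs_frac_part_ge[OF m(3,1,2)]) simp
      finally show ?thesis
        using that by (simp add: laurent_abs_poly_to_laurent)
    qed
    then have "ereal ?c \<le> Liminf poly_at_infinity (?F \<theta> \<gamma>)"
      by (intro Liminf_bounded) (simp add: poly_at_infinity_def eventually_inf_principal)
    then show "ereal ?c \<le> (SUP \<gamma>. Liminf poly_at_infinity (?F \<theta> \<gamma>))"
      by (rule SUP_upper2[OF UNIV_I])
  qed
qed

end
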